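(* Let $\nu$ be a probability measure on $[0,\infty)$ with unbounded support and with all positive moments finite. (1) Hardy's condition, i.e. $$\int_0^\infty e^{c\sqrt{x}}\,\nu(dx)<\infty\quad\text{for some } c>0,$$ is satisfied if and only if $\overline{\nu}(x)=O(e^{-c\sqrt{x}})$ as $x\to\infty$ for some $c>0$. Consequently, if Hardy's condition holds then, for some $c>0$, the function $G_*(x)=c\,e^{x/2}$ belongs to $\mathscr{A}_{\mathscr{D}}$ and satisfies $$\overline{\nu}(x)=O\left(e^{-G_*(\log x)}\right)\ (x\to\infty)\qquad\text{and}\qquad \sum^\infty e^{-\frac12\overleftarrow{G_*'}(n)}=\infty,$$ where $\overleftarrow{G_*'}$ is the inverse of the increasing function $G_*'$. (2) If $\nu(dx)=\nu(x)\,dx$ and, for some $\alpha>0$, $$\nu(x)\asymp e^{-\frac{\alpha\sqrt{x}}{\log x}}\quad (x\to\infty),$$ then $\nu$ does not satisfy Hardy's condition, i.e. $\int_0^\infty e^{c\sqrt{x}}\nu(x)\,dx=\infty$ for all $c>0$, yet $\nu$ is moment determinate.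
   Context: A positive measure on $[0,\infty)$ with all moments of order $n=0,1,2,\dots$ finite is called moment determinate if it is the only positive measure on $[0,\infty)$ with these moments (Stieltjes moment problem). $\overline{\nu}(x)=\int_x^\infty\nu(dy)$ denotes the tail of $\nu$; when $\nu$ is absolutely continuous its density is also denoted $\nu(x)$. For an interval $I\subseteq\mathbb{R}$, $C^2_+(I)$ denotes the set of twice differentiable functions on $I$ whose second derivative is continuous and strictly positive on $I$. The set $\mathscr{A}$ of asymptotically parabolic functions is the set of all $G\in C_+^2((a,\infty))$, for some $a\ge-\infty$, such that $$\lim_{u\to\infty}\frac{G''\left(u+w\,(G''(u))^{-1/2}\right)}{G''(u)}=1\quad\text{locally uniformly in } w\in\mathbb{R},$$ and $\mathscr{A}_{\mathscr{D}}=\{G_*\in\mathscr{A}:\ \lim_{x\to\infty}G_*(x)/x=\infty\}$. $f(x)=O(g(x))$ as $x\to\infty$ means $\limsup_{x\to\infty}|f(x)/g(x)|<\infty$; $f(x)\asymp g(x)$ means $f(x)=O(g(x))$ and $g(x)=O(f(x))$ as $x\to\infty$. $\sum^\infty$ means the sum over integers $n\ge N$ for some sufficiently large $N\geq 1$. *)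

theory Defs
  imports "HOL-Probability.Probability" "HOL-Library.Landau_Symbols"
begin

text \<open>Measures on \<open>[0,\<infinity>)\<close> are Borel measures on \<open>\<real>\<close> that do not charge the negative half-line.\<close>

definition halfline_measure :: "real measure \<Rightarrow> bool" where
  "halfline_measure M \<longleftrightarrow> sets M = sets borel \<and> emeasure M {..<0} = 0"

text \<open>The case \<open>n = 0\<close> says that the measure is finite.\<close>

definition finite_moments :: "real measure \<Rightarrow> bool" where
  "finite_moments M \<longleftrightarrow> (\<forall>n::nat. integrable M (\<lambda>x. x ^ n))"

definition moment_determinate :: "real measure \<Rightarrow> bool" where
  "moment_determinate M \<longleftrightarrow>
     halfline_measure M \<and> finite_moments M \<and>
     (\<forall>N. halfline_measure N \<and> finite_moments N \<and>
          (\<forall>n::nat. (\<integral>x. x ^ n \<partial>N) = (\<integral>x. x ^ n \<partial>M)) \<longrightarrow> N = M)"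

definition measure_support :: "real measure \<Rightarrow> real set" where
  "measure_support M = {x. \<forall>U. open U \<and> x \<in> U \<longrightarrow> emeasure M U > 0}"

definition tail :: "real measure \<Rightarrow> real \<Rightarrow> real" where
  "tail M x = measure M {x..}"

definition hardy_condition :: "real measure \<Rightarrow> bool" where
  "hardy_condition M \<longleftrightarrow> (\<exists>c>0. (\<integral>\<^sup>+x\<in>{0..}. ennreal (exp (c * sqrt x)) \<partial>M) < \<infinity>)"

definition C2_plus :: "real set \<Rightarrow> (real \<Rightarrow> real) set" where
  "C2_plus I = {f. \<exists>f' f''.
     (\<forall>x\<in>I. (f has_real_derivative f' x) (at x within I)) \<and>
     (\<forall>x\<in>I. (f' has_real_derivative f'' x) (at x within I)) \<and>
     continuous_on I f'' \<and> (\<forall>x\<in>I. f'' x > 0)}"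

text \<open>
  A function on \<open>(a,\<infinity>)\<close> is represented by a total function, whose values outside \<open>(a,\<infinity>)\<close>
  are irrelevant; therefore the points at which the second derivative is evaluated are required
  to lie in \<open>(a,\<infinity>)\<close> eventually, locally uniformly in \<open>w\<close>.
\<close>

definition asymptotically_parabolic :: "(real \<Rightarrow> real) set" where
  "asymptotically_parabolic = {G. \<exists>a::ereal. a < \<infinity> \<and>
     G \<in> C2_plus {x. a < ereal x} \<and>
     (\<forall>K::real set. compact K \<longrightarrow>
        (\<forall>\<^sub>F u in at_top. \<forall>w\<in>K. a < ereal (u + w * deriv (deriv G) u powr (-1/2))) \<and>
        uniform_limit K
          (\<lambda>u w. deriv (deriv G) (u + w * deriv (deriv G) u powr (-1/2)) / deriv (deriv G) u)
          (\<lambda>w. 1) at_top)}"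

definition asymptotically_parabolic_D :: "(real \<Rightarrow> real) set" where
  "asymptotically_parabolic_D =
     {G \<in> asymptotically_parabolic. filterlim (\<lambda>x. G x / x) at_top at_top}"

end

theory Submission
  imports Defs "HOL-Real_Asymp.Real_Asymp"
begin

text \<open>
  If \<open>M\<close> and \<open>N\<close> have the same moments, all derivatives at \<open>0\<close> of
  \<open>\<integral> cos (t * sqrt x) dM - \<integral> cos (t * sqrt x) dN\<close> vanish, and the \<open>n\<close>-th derivative is bounded by
  \<open>b n\<close>, a bound for the sum of the moments of order \<open>n / 2\<close>. When \<open>b\<close> is log-convex and
  \<open>\<Sum> b n / b (n + 1)\<close> diverges, Bang's proof of the Denjoy-Carleman theorem makes this function zero,
  and Levy's uniqueness theorem, applied to the symmetrised distributions of \<open>sqrt x\<close>, gives \<open>M = N\<close>.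
  For a density of order \<open>exp (- \<alpha> * sqrt x / ln x)\<close> one can take
  \<open>b (n + 1) / b n\<close> of order \<open>n * ln n\<close>.
\<close>

subsection \<open>Quasi-analyticity after Bang\<close>

text \<open>
  \<open>F n\<close> plays the \<open>n\<close>-th derivative of \<open>F 0\<close>; only Taylor's inequality is used, so no
  differentiation under the integral is needed later. Since the hypothesis on \<open>F n t\<close> is automatic for
  \<open>n > N\<close>, the Taylor expansion of order \<open>Suc N - n\<close> involves only the ratios \<open>r k\<close> with \<open>k \<le> N\<close>.
\<close>

lemma bang_step:
  fixes F :: "nat \<Rightarrow> real \<Rightarrow> real" and M r :: "nat \<Rightarrow> real"
  assumes taylor: "\<And>n m t h. \<bar>F n (t + h)\<bar> \<le> (\<Sum>i<m. \<bar>F (n + i) t\<bar> * \<bar>h\<bar> ^ i / fact i) + M (n + m) * \<bar>h\<bar> ^ m / fact m"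
    and bound: "\<And>n t. \<bar>F n t\<bar> \<le> M n"
    and M_Suc: "\<And>n. M (Suc n) = r n * M n"
    and r: "mono r" "\<And>n. r n > 0"
    and small: "\<And>n. \<bar>F n t\<bar> \<le> exp (real n - real (Suc N)) * M n"
    and h: "exp 1 * r N * \<bar>h\<bar> \<le> 1"
  shows "\<bar>F n (t + h)\<bar> \<le> exp (real n - real N) * M n"
proof -
  have M_nonneg: "M n \<ge> 0" for n using bound[of n 0] by linarith
  show ?thesis
  proof (cases "n \<ge> N")
    case True
    have "\<bar>F n (t + h)\<bar> \<le> 1 * M n" using bound by simp
    also have "\<dots> \<le> exp (real n - real N) * M n"
      by (rule mult_right_mono) (use True M_nonneg in auto)
    finally show ?thesis .
  next
    case False
    define m where "m = Suc N - n"
    have nm: "n + m = Suc N" using False by (simp add: m_def)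
    have grow: "M (n + i) \<le> r N ^ i * M n" if "i \<le> m" for i
      using that
    proof (induction i)
      case (Suc i)
      have "M (n + Suc i) = r (n + i) * M (n + i)" by (simp add: M_Suc)
      also have "\<dots> \<le> r N * M (n + i)"
        by (rule mult_right_mono[OF monoD[OF r(1)]]) (use Suc nm M_nonneg in auto)
      also have "\<dots> \<le> r N * (r N ^ i * M n)"
        by (rule mult_left_mono) (use Suc r(2)[of N] in auto)
      finally show ?case by simp
    qed simp
    have term_le: "exp (real (n + i) - real (Suc N)) * M (n + i) * \<bar>h\<bar> ^ i / fact i
        \<le> exp (real n - real (Suc N)) * M n * ((exp 1 * r N * \<bar>h\<bar>) ^ i / fact i)" if "i \<le> m" for i
    proof -
      have e: "exp (real (n + i) - real (Suc N)) = exp (real n - real (Suc N)) * exp 1 ^ i"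
        by (simp add: exp_of_nat_mult[symmetric] exp_add[symmetric] algebra_simps)
      have "exp (real (n + i) - real (Suc N)) * M (n + i) * \<bar>h\<bar> ^ i / fact i
          \<le> exp (real (n + i) - real (Suc N)) * (r N ^ i * M n) * \<bar>h\<bar> ^ i / fact i"
        by (intro divide_right_mono mult_right_mono mult_left_mono grow that) auto
      thus ?thesis unfolding e by (simp add: power_mult_distrib mult_ac)
    qed
    have "\<bar>F n (t + h)\<bar> \<le> (\<Sum>i<m. \<bar>F (n + i) t\<bar> * \<bar>h\<bar> ^ i / fact i) + M (n + m) * \<bar>h\<bar> ^ m / fact m"
      by (rule taylor)
    also have "\<dots> \<le> (\<Sum>i<m. exp (real (n + i) - real (Suc N)) * M (n + i) * \<bar>h\<bar> ^ i / fact i)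
        + exp (real (n + m) - real (Suc N)) * M (n + m) * \<bar>h\<bar> ^ m / fact m"
      by (intro add_mono sum_mono divide_right_mono mult_right_mono small) (auto simp: nm)
    also have "\<dots> = (\<Sum>i\<le>m. exp (real (n + i) - real (Suc N)) * M (n + i) * \<bar>h\<bar> ^ i / fact i)"
      by (simp add: lessThan_Suc_atMost[symmetric])
    also have "\<dots> \<le> (\<Sum>i\<le>m. exp (real n - real (Suc N)) * M n * ((exp 1 * r N * \<bar>h\<bar>) ^ i / fact i))"
      by (intro sum_mono term_le) auto
    also have "\<dots> = exp (real n - real (Suc N)) * M n * (\<Sum>i\<le>m. (exp 1 * r N * \<bar>h\<bar>) ^ i / fact i)"
      by (simp add: sum_distrib_left)
    also have "\<dots> \<le> exp (real n - real (Suc N)) * M n * exp (exp 1 * r N * \<bar>h\<bar>)"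
    proof (intro mult_left_mono mult_nonneg_nonneg M_nonneg)
      have "(\<Sum>i\<le>m. (exp 1 * r N * \<bar>h\<bar>) ^ i / fact i) \<le> (\<Sum>i. (exp 1 * r N * \<bar>h\<bar>) ^ i / fact i)"
        using summable_exp_generic[of "exp 1 * r N * \<bar>h\<bar>"] r(2)[of N]
        by (intro sum_le_suminf) (auto simp: field_simps)
      also have "\<dots> = exp (exp 1 * r N * \<bar>h\<bar>)" by (simp add: exp_def field_simps)
      finally show "(\<Sum>i\<le>m. (exp 1 * r N * \<bar>h\<bar>) ^ i / fact i) \<le> exp (exp 1 * r N * \<bar>h\<bar>)" .
    qed auto
    also have "\<dots> \<le> exp (real n - real (Suc N)) * M n * exp 1"
      by (intro mult_left_mono mult_nonneg_nonneg M_nonneg) (use h in auto)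
    also have "\<dots> = exp (real n - real N) * M n"
      by (simp add: exp_add[symmetric] mult_ac flip: mult.assoc)
    finally show ?thesis .
  qed
qed

lemma bang_iterate:
  fixes F :: "nat \<Rightarrow> real \<Rightarrow> real" and M r :: "nat \<Rightarrow> real"
  assumes taylor: "\<And>n m t h. \<bar>F n (t + h)\<bar> \<le> (\<Sum>i<m. \<bar>F (n + i) t\<bar> * \<bar>h\<bar> ^ i / fact i) + M (n + m) * \<bar>h\<bar> ^ m / fact m"
    and bound: "\<And>n t. \<bar>F n t\<bar> \<le> M n"
    and M_Suc: "\<And>n. M (Suc n) = r n * M n"
    and r: "mono r" "\<And>n. r n > 0"
    and zero: "\<And>n. F n 0 = 0"
  shows "0 \<le> t \<Longrightarrow> t \<le> (\<Sum>k=j..<j+K. 1 / (exp 1 * r k)) \<Longrightarrow> \<bar>F n t\<bar> \<le> exp (real n - real j) * M n"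
proof (induction K arbitrary: j t n)
  case 0
  have "M n \<ge> 0" for n using bound[of n 0] by linarith
  with 0 show ?case by (simp add: zero)
next
  case (Suc K)
  define d where "d = 1 / (exp 1 * r j)"
  define s where "s = max 0 (t - d)"
  have d: "d > 0" using r(2)[of j] by (simp add: d_def)
  have "(\<Sum>k=j..<j+Suc K. 1 / (exp 1 * r k)) = d + (\<Sum>k=Suc j..<Suc j+K. 1 / (exp 1 * r k))"
    by (subst sum.atLeast_Suc_lessThan) (auto simp: d_def)
  moreover have "0 \<le> (\<Sum>k=Suc j..<Suc j+K. 1 / (exp 1 * r k))"
    using r(2) by (intro sum_nonneg) (auto simp: less_imp_le)
  ultimately have s: "0 \<le> s" "s \<le> (\<Sum>k=Suc j..<Suc j+K. 1 / (exp 1 * r k))"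
    using Suc.prems by (auto simp: s_def)
  have "\<bar>t - s\<bar> \<le> d" using Suc.prems d by (auto simp: s_def)
  hence "exp 1 * r j * \<bar>t - s\<bar> \<le> 1"
    using r(2)[of j] by (simp add: d_def field_simps)
  from bang_step[where F=F and M=M and r=r and t=s and N=j and h="t-s" and n=n, OF taylor bound M_Suc r Suc.IH[OF s] this]
  show ?case by simp
qed

lemma quasi_analytic_vanish:
  fixes F :: "nat \<Rightarrow> real \<Rightarrow> real" and M r :: "nat \<Rightarrow> real"
  assumes taylor: "\<And>n m t h. \<bar>F n (t + h)\<bar> \<le> (\<Sum>i<m. \<bar>F (n + i) t\<bar> * \<bar>h\<bar> ^ i / fact i) + M (n + m) * \<bar>h\<bar> ^ m / fact m"
    and bound: "\<And>n t. \<bar>F n t\<bar> \<le> M n"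
    and M_Suc: "\<And>n. M (Suc n) = r n * M n"
    and r: "mono r" "\<And>n. r n > 0"
    and zero: "\<And>n. F n 0 = 0"
    and diverges: "\<not> summable (\<lambda>n. 1 / r n)"
    and t: "t \<ge> 0"
  shows "F n t = 0"
proof -
  have small: "\<bar>F n t\<bar> \<le> exp (real n - real j) * M n" for j
  proof -
    have "\<exists>K. t \<le> (\<Sum>k=j..<j+K. 1 / (exp 1 * r k))"
    proof (rule ccontr)
      assume "\<not> ?thesis"
      hence *: "(\<Sum>k=j..<j+K. 1 / (exp 1 * r k)) \<le> t" for K by (meson linear)
      have "summable (\<lambda>k. 1 / (exp 1 * r (k + j)))"
      proof (rule bounded_imp_summable)
        show "(\<Sum>k\<le>K. 1 / (exp 1 * r (k + j))) \<le> t" for K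
          using *[of "Suc K"] sum.shift_bounds_nat_ivl[of "\<lambda>k. 1 / (exp 1 * r k)" 0 j "Suc K"]
          by (simp add: atLeast0LessThan lessThan_Suc_atMost add.commute)
      qed (use r(2) in \<open>auto simp: less_imp_le\<close>)
      hence "summable (\<lambda>k. 1 / (exp 1 * r k))" by (subst (asm) summable_iff_shift)
      hence "summable (\<lambda>k. exp 1 * (1 / (exp 1 * r k)))" by (rule summable_mult)
      with diverges show False by simp
    qed
    then obtain K where K: "t \<le> (\<Sum>k=j..<j+K. 1 / (exp 1 * r k))" ..
    show ?thesis
      by (rule bang_iterate[where F=F and M=M and r=r, OF taylor bound M_Suc r zero t K])
  qed
  have "(\<lambda>j. exp (real n - real j) * M n) \<longlonglongrightarrow> 0" by real_asymp
  hence "\<bar>F n t\<bar> \<le> 0" by (rule LIMSEQ_le_const) (use small in auto)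
  thus ?thesis by simp
qed

lemma cos_taylor:
  fixes a d :: real
  shows "\<bar>cos (a + d) - (\<Sum>i<m. cos (a + real i * pi / 2) * d ^ i / fact i)\<bar> \<le> \<bar>d\<bar> ^ m / fact m"
proof -
  have D: "((\<lambda>x. cos (a + x + real i * pi / 2)) has_real_derivative cos (a + x + real (Suc i) * pi / 2)) (at x)" for i x
  proof -
    have "a + x + real (Suc i) * pi / 2 = (a + x + real i * pi / 2) + pi / 2"
      by (simp add: field_simps)
    moreover have "cos (y + pi / 2) = - sin y" for y :: real by (simp add: cos_add)
    ultimately have "cos (a + x + real (Suc i) * pi / 2) = - sin (a + x + real i * pi / 2)"
      by (simp only:)
    thus ?thesis by (auto intro!: derivative_eq_intros)
  qed
  obtain t where "cos (a + d) = (\<Sum>i<m. cos (a + real i * pi / 2) / fact i * d ^ i)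
      + cos (a + t + real m * pi / 2) / fact m * d ^ m"
    using Maclaurin_all_le[where f = "\<lambda>x. cos (a + x)" and diff = "\<lambda>i x. cos (a + x + real i * pi / 2)"
        and x = d and n = m] D by auto
  hence "\<bar>cos (a + d) - (\<Sum>i<m. cos (a + real i * pi / 2) * d ^ i / fact i)\<bar>
      = \<bar>cos (a + t + real m * pi / 2)\<bar> * (\<bar>d\<bar> ^ m / fact m)"
    by (simp add: abs_mult power_abs)
  also have "\<dots> \<le> 1 * (\<bar>d\<bar> ^ m / fact m)" by (intro mult_right_mono) auto
  finally show ?thesis by simp
qed

subsection \<open>Carleman's criterion on the half-line\<close>

lemma halfline_AE_nonneg:
  assumes "halfline_measure N" shows "AE x in N. x \<ge> 0"
proof (rule AE_I)
  show "{x \<in> space N. \<not> 0 \<le> x} \<subseteq> {..<0}" by auto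
qed (use assms in \<open>auto simp: halfline_measure_def\<close>)

lemma integrable_sqrt_power:
  assumes "halfline_measure N" "finite_moments N"
  shows "integrable N (\<lambda>x. sqrt x ^ n)"
proof (rule Bochner_Integration.integrable_bound)
  have "integrable N (\<lambda>x. x ^ 0)" "integrable N (\<lambda>x. x ^ n)"
    using assms(2) unfolding finite_moments_def by blast+
  thus "integrable N (\<lambda>x. 1 + norm (x ^ n))" by (intro Bochner_Integration.integrable_add integrable_norm) auto
  have [measurable_cong]: "sets N = sets borel" using assms(1) by (simp add: halfline_measure_def)
  show "(\<lambda>x. sqrt x ^ n) \<in> borel_measurable N" by measurable
  show "AE x in N. norm (sqrt x ^ n) \<le> norm (1 + norm (x ^ n))"
    using halfline_AE_nonneg[OF assms(1)]
  proof eventually_elim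
    case (elim x)
    show ?case
    proof (cases "x \<le> 1")
      case True
      hence "sqrt x ^ n \<le> 1" using elim by (intro power_le_one) auto
      thus ?thesis using elim by (simp add: add_increasing2)
    next
      case False
      hence "sqrt x \<le> x" using elim by (simp add: real_le_lsqrt power2_eq_square)
      hence "sqrt x ^ n \<le> x ^ n" using elim by (intro power_mono) auto
      thus ?thesis using elim by simp
    qed
  qed
qed

text \<open>
  The odd case is the weighted AM-GM inequality \<open>2 * sqrt x \<le> r j + x / r j\<close>; taking each ratio \<open>r j\<close>
  twice makes the bounds for the even and odd powers fit together exactly.
\<close>

lemma sqrt_moment_le:
  fixes r :: "nat \<Rightarrow> real"
  assumes N: "halfline_measure N" "finite_moments N"
    and r: "\<And>k. r k > 0"
    and m: "\<And>n. (\<integral>x. x ^ n \<partial>N) \<le> C * (\<Prod>k<n. (r k)\<^sup>2)"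
  shows "(\<integral>x. sqrt x ^ n \<partial>N) \<le> C * (\<Prod>k<n. r (k div 2))"
proof -
  have int: "integrable N (\<lambda>x. x ^ n)" for n using N by (simp add: finite_moments_def)
  have even: "(\<Prod>k<2 * j. r (k div 2)) = (\<Prod>k<j. (r k)\<^sup>2)" for j
    by (induction j) (simp_all add: power2_eq_square)
  show ?thesis
  proof (cases "even n")
    case True
    then obtain j where j: "n = 2 * j" by blast
    have "(\<integral>x. sqrt x ^ n \<partial>N) = (\<integral>x. x ^ j \<partial>N)"
    proof (rule integral_cong_AE)
      show "AE x in N. sqrt x ^ n = x ^ j"
        using halfline_AE_nonneg[OF N(1)] by eventually_elim (simp add: j power_mult)
    qed (use int integrable_sqrt_power[OF N] in auto)
    with m[of j] show ?thesis by (simp add: j even)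
  next
    case False
    then obtain j where j: "n = Suc (2 * j)" by (metis oddE Suc_eq_plus1)
    have "(\<integral>x. sqrt x ^ n \<partial>N) \<le> (\<integral>x. (r j * x ^ j + x ^ Suc j / r j) / 2 \<partial>N)"
    proof (rule integral_mono_AE)
      show "AE x in N. sqrt x ^ n \<le> (r j * x ^ j + x ^ Suc j / r j) / 2"
        using halfline_AE_nonneg[OF N(1)]
      proof eventually_elim
        case (elim x)
        have "2 * sqrt x \<le> r j + x / r j"
        proof -
          have "0 \<le> (r j - sqrt x)\<^sup>2 / r j" using r[of j] by simp
          also have "\<dots> = r j + x / r j - 2 * sqrt x"
            using r[of j] elim by (simp add: power2_diff power2_eq_square[of "r j"] field_simps)
          finally show ?thesis by simp
        qed
        hence "x ^ j * (2 * sqrt x) \<le> x ^ j * (r j + x / r j)"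
          using elim by (intro mult_left_mono) auto
        moreover have "sqrt x ^ n = x ^ j * sqrt x" using elim by (simp add: j power_mult)
        ultimately show ?case by (simp add: algebra_simps)
      qed
    qed (use int[of j] int[of "Suc j"] integrable_sqrt_power[OF N] in auto)
    also have "\<dots> = (r j * (\<integral>x. x ^ j \<partial>N) + (\<integral>x. x ^ Suc j \<partial>N) / r j) / 2"
      using int[of j] int[of "Suc j"] by simp
    also have "\<dots> \<le> (r j * (C * (\<Prod>k<j. (r k)\<^sup>2)) + (C * (\<Prod>k<Suc j. (r k)\<^sup>2)) / r j) / 2"
      using r by (intro divide_right_mono add_mono mult_left_mono m) (auto intro: less_imp_le)
    also have "\<dots> = C * (\<Prod>k<n. r (k div 2))"
      using r[of j] by (simp add: j even power2_eq_square)
    finally show ?thesis .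
  qed
qed

lemma halfline_prob_eqI:
  assumes M: "prob_space M" "halfline_measure M" and N: "prob_space N" "halfline_measure N"
    and eq: "\<And>t. t \<ge> 0 \<Longrightarrow> (\<integral>x. cos (t * sqrt x) \<partial>M) = (\<integral>x. cos (t * sqrt x) \<partial>N)"
  shows "M = N"
proof -
  define B where "B = measure_pmf (bernoulli_pmf (1/2))"
  define g :: "real \<times> bool \<Rightarrow> real" where "g = (\<lambda>z. if snd z then sqrt (fst z) else - sqrt (fst z))"
  define S where "S = (\<lambda>M :: real measure. distr (M \<Otimes>\<^sub>M B) borel g)"
  interpret B: prob_space B unfolding B_def by (rule measure_pmf.prob_space_axioms)
  have [measurable_cong]: "sets B = sets (count_space UNIV)" by (simp add: B_def)
  have *: "real_distribution (S M) \<and> char (S M) t = of_real (\<integral>x. cos (\<bar>t\<bar> * sqrt x) \<partial>M)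
      \<and> distr (S M) borel (\<lambda>y. y\<^sup>2) = M"
    if "prob_space M" "halfline_measure M" for M :: "real measure" and t
  proof (intro conjI)
    interpret M: prob_space M by fact
    interpret MB: pair_prob_space M B ..
    have sets_M [measurable_cong]: "sets M = sets borel" using that(2) by (simp add: halfline_measure_def)
    have g [measurable]: "g \<in> borel_measurable (M \<Otimes>\<^sub>M B)" unfolding g_def by measurable
    show "real_distribution (S M)" unfolding S_def by (rule MB.real_distribution_distr) measurable
    have int: "integrable (M \<Otimes>\<^sub>M B) (\<lambda>z. iexp (t * g z))"
      by (rule MB.integrable_const_bound[where B=1]) auto
    have "char (S M) t = (CLINT z|M \<Otimes>\<^sub>M B. iexp (t * g z))"
      unfolding char_def S_def by (rule integral_distr) auto
    also have "\<dots> = (CLINT x|M. CLINT b|B. iexp (t * g (x, b)))"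
      by (rule MB.integral_fst'[symmetric, OF int])
    also have "\<dots> = (CLINT x|M. of_real (cos (\<bar>t\<bar> * sqrt x)))"
    proof (rule Bochner_Integration.integral_cong[OF refl])
      fix x
      have "cos (\<bar>t\<bar> * sqrt x) = cos (t * sqrt x)" by (auto simp: abs_if)
      thus "(CLINT b|B. iexp (t * g (x, b))) = complex_of_real (cos (\<bar>t\<bar> * sqrt x))"
        unfolding B_def
        by (subst integral_measure_pmf[of UNIV])
           (simp_all add: UNIV_bool g_def complex_eq_iff Re_exp Im_exp)
    qed
    finally show "char (S M) t = of_real (\<integral>x. cos (\<bar>t\<bar> * sqrt x) \<partial>M)" by simp
    have "AE x in distr (M \<Otimes>\<^sub>M B) M fst. x \<ge> 0"
      unfolding B.distr_pair_fst by (rule halfline_AE_nonneg) fact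
    hence "AE z in M \<Otimes>\<^sub>M B. fst z \<ge> 0" by (rule AE_distrD[rotated]) measurable
    hence "AE z in M \<Otimes>\<^sub>M B. (g z)\<^sup>2 = fst z" by eventually_elim (auto simp: g_def)
    hence "distr (M \<Otimes>\<^sub>M B) M (\<lambda>z. (g z)\<^sup>2) = distr (M \<Otimes>\<^sub>M B) M fst"
      by (intro distr_cong_AE) auto
    also have "\<dots> = M" by (rule B.distr_pair_fst)
    finally have "distr (M \<Otimes>\<^sub>M B) M (\<lambda>z. (g z)\<^sup>2) = M" .
    moreover have "distr (S M) borel (\<lambda>y. y\<^sup>2) = distr (M \<Otimes>\<^sub>M B) borel (\<lambda>z. (g z)\<^sup>2)"
      unfolding S_def by (subst distr_distr) (auto simp: o_def)
    ultimately show "distr (S M) borel (\<lambda>y. y\<^sup>2) = M"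
      using distr_cong[OF refl sets_M refl, of "M \<Otimes>\<^sub>M B" "\<lambda>z. (g z)\<^sup>2"] by simp
  qed
  have "char (S M) = char (S N)"
    using *[OF M] *[OF N] eq by (auto simp: fun_eq_iff)
  hence "S M = S N" using *[OF M] *[OF N] by (intro Levy_uniqueness) auto
  thus ?thesis using *[OF M] *[OF N] by metis
qed

lemma integrable_sqrt_power_cos:
  assumes "halfline_measure M" "finite_moments M"
  shows "integrable M (\<lambda>x. sqrt x ^ n * cos (t * sqrt x + b))"
proof (rule Bochner_Integration.integrable_bound[OF integrable_sqrt_power[OF assms, of n]])
  have [measurable_cong]: "sets M = sets borel" using assms(1) by (simp add: halfline_measure_def)
  show "(\<lambda>x. sqrt x ^ n * cos (t * sqrt x + b)) \<in> borel_measurable M" by measurable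
qed (auto simp: abs_mult intro!: mult_left_le)

lemma sqrt_power_cos_taylor:
  fixes M :: "real measure"
  assumes M: "halfline_measure M" "finite_moments M"
  defines "J \<equiv> \<lambda>n t. \<integral>x. sqrt x ^ n * cos (t * sqrt x + real n * pi / 2) \<partial>M"
  shows "\<bar>J n (t + h) - (\<Sum>i<m. J (n + i) t * h ^ i / fact i)\<bar> \<le> (\<integral>x. sqrt x ^ (n + m) \<partial>M) * \<bar>h\<bar> ^ m / fact m"
proof -
  note int [simp] = integrable_sqrt_power_cos[OF M] integrable_sqrt_power[OF M]
  define D where "D = (\<lambda>x. sqrt x ^ n * cos ((t + h) * sqrt x + real n * pi / 2)
    - (\<Sum>i<m. sqrt x ^ (n + i) * cos (t * sqrt x + real (n + i) * pi / 2) * h ^ i / fact i))"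
  have D: "D x = sqrt x ^ n * (cos ((t * sqrt x + real n * pi / 2) + h * sqrt x)
     - (\<Sum>i<m. cos ((t * sqrt x + real n * pi / 2) + real i * pi / 2) * (h * sqrt x) ^ i / fact i))" for x
    unfolding D_def right_diff_distrib sum_distrib_left
    by (intro arg_cong2[where f = "(-)"] sum.cong)
       (simp_all add: algebra_simps power_add power_mult_distrib add_divide_distrib)
  have "\<bar>J n (t + h) - (\<Sum>i<m. J (n + i) t * h ^ i / fact i)\<bar> = \<bar>\<integral>x. D x \<partial>M\<bar>"
    unfolding D_def J_def by (subst Bochner_Integration.integral_diff) (auto simp: Bochner_Integration.integral_sum)
  also have "\<dots> \<le> (\<integral>x. \<bar>D x\<bar> \<partial>M)" by (rule integral_abs_bound)
  also have "\<dots> \<le> (\<integral>x. sqrt x ^ (n + m) * (\<bar>h\<bar> ^ m / fact m) \<partial>M)"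
  proof (rule integral_mono_AE)
    show "integrable M (\<lambda>x. \<bar>D x\<bar>)" unfolding D_def
      by (intro integrable_abs Bochner_Integration.integrable_diff Bochner_Integration.integrable_sum) auto
    show "AE x in M. \<bar>D x\<bar> \<le> sqrt x ^ (n + m) * (\<bar>h\<bar> ^ m / fact m)"
      using halfline_AE_nonneg[OF M(1)]
    proof eventually_elim
      case (elim x)
      have "\<bar>D x\<bar> \<le> sqrt x ^ n * (\<bar>h * sqrt x\<bar> ^ m / fact m)"
        using elim mult_left_mono[OF cos_taylor[of "t * sqrt x + real n * pi / 2" "h * sqrt x" m], of "sqrt x ^ n"]
        unfolding D abs_mult[of "sqrt x ^ n"] by simp
      also have "\<dots> = sqrt x ^ (n + m) * (\<bar>h\<bar> ^ m / fact m)"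
        using elim by (simp add: abs_mult power_mult_distrib power_add)
      finally show ?case .
    qed
  qed auto
  finally show ?thesis by simp
qed

theorem carleman_moment_determinate:
  fixes r :: "nat \<Rightarrow> real"
  assumes M: "prob_space M" "halfline_measure M" "finite_moments M"
    and r: "mono r" "\<And>k. r k > 0" "\<not> summable (\<lambda>k. 1 / r k)"
    and m: "\<And>n. (\<integral>x. x ^ n \<partial>M) \<le> C * (\<Prod>k<n. (r k)\<^sup>2)"
  shows "moment_determinate M"
  unfolding moment_determinate_def
proof (intro conjI allI impI; (elim conjE)?)
  fix N assume N: "halfline_measure N" "finite_moments N"
    and eq: "\<forall>n. (\<integral>x. x ^ n \<partial>N) = (\<integral>x. x ^ n \<partial>M)"
  define J where "J = (\<lambda>M n t. \<integral>x. sqrt x ^ n * cos (t * sqrt x + real n * pi / 2) \<partial>(M :: real measure))"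
  define F where "F = (\<lambda>n t. J M n t - J N n t)"
  define b where "b = (\<lambda>n. 2 * C * (\<Prod>k<n. r (k div 2)))"
  have half: "(\<integral>x. sqrt x ^ n \<partial>M) + (\<integral>x. sqrt x ^ n \<partial>N) \<le> b n" for n
    using sqrt_moment_le[OF M(2,3) r(2) m, where n = n] sqrt_moment_le[where r = r, OF N r(2), where C = C and n = n] eq m
    by (simp add: b_def)
  have taylor: "\<bar>F n (t + h) - (\<Sum>i<m. F (n + i) t * h ^ i / fact i)\<bar> \<le> b (n + m) * \<bar>h\<bar> ^ m / fact m" for n m t h
  proof -
    have "\<bar>F n (t + h) - (\<Sum>i<m. F (n + i) t * h ^ i / fact i)\<bar>
       = \<bar>(J M n (t + h) - (\<Sum>i<m. J M (n + i) t * h ^ i / fact i))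
          - (J N n (t + h) - (\<Sum>i<m. J N (n + i) t * h ^ i / fact i))\<bar>"
      by (simp add: F_def left_diff_distrib diff_divide_distrib sum_subtractf)
    also have "\<dots> \<le> (\<integral>x. sqrt x ^ (n + m) \<partial>M) * \<bar>h\<bar> ^ m / fact m + (\<integral>x. sqrt x ^ (n + m) \<partial>N) * \<bar>h\<bar> ^ m / fact m"
      using sqrt_power_cos_taylor[OF M(2,3), of n t h m] sqrt_power_cos_taylor[OF N, of n t h m]
      unfolding J_def by linarith
    also have "\<dots> = ((\<integral>x. sqrt x ^ (n + m) \<partial>M) + (\<integral>x. sqrt x ^ (n + m) \<partial>N)) * \<bar>h\<bar> ^ m / fact m"
      by (simp add: algebra_simps add_divide_distrib)
    also have "\<dots> \<le> b (n + m) * \<bar>h\<bar> ^ m / fact m"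
      by (intro divide_right_mono mult_right_mono half) auto
    finally show ?thesis .
  qed
  have zero: "F n 0 = 0" for n
  proof (cases "even n")
    case True
    then obtain j where j: "n = 2 * j" by blast
    have "(\<integral>x. sqrt x ^ n \<partial>L) = (\<integral>x. x ^ j \<partial>L)" if "halfline_measure L" "finite_moments L" for L
    proof (rule integral_cong_AE)
      show "AE x in L. sqrt x ^ n = x ^ j"
        using halfline_AE_nonneg[OF that(1)] by eventually_elim (simp add: j power_mult)
    qed (use that integrable_sqrt_power[OF that] in \<open>auto simp: finite_moments_def\<close>)
    from this[OF M(2,3)] this[OF N] eq show ?thesis by (simp add: F_def J_def)
  next
    case False
    then obtain j where "n = 2 * j + 1" by (metis oddE)
    hence "cos (real n * pi / 2) = cos (real (2 * j + 1) * (pi / 2))" by simp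
    also have "\<dots> = 0" by (subst cos_zero_iff) (auto intro!: exI[of _ "2 * j + 1"])
    finally show ?thesis by (simp add: F_def J_def)
  qed
  have F0: "F 0 t = 0" if "t \<ge> 0" for t
  proof (rule quasi_analytic_vanish[where F = F and M = b and r = "\<lambda>k. r (k div 2)"])
    fix n m t h
    have "\<bar>F n (t + h)\<bar> \<le> \<bar>\<Sum>i<m. F (n + i) t * h ^ i / fact i\<bar> + b (n + m) * \<bar>h\<bar> ^ m / fact m"
      using taylor[of n t h m] by linarith
    also have "\<bar>\<Sum>i<m. F (n + i) t * h ^ i / fact i\<bar> \<le> (\<Sum>i<m. \<bar>F (n + i) t * h ^ i / fact i\<bar>)"
      by (rule sum_abs)
    finally show "\<bar>F n (t + h)\<bar> \<le> (\<Sum>i<m. \<bar>F (n + i) t\<bar> * \<bar>h\<bar> ^ i / fact i) + b (n + m) * \<bar>h\<bar> ^ m / fact m"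
      by (simp add: abs_mult power_abs)
  next
    show "\<bar>F n t\<bar> \<le> b n" for n t using taylor[of n t 0 0] by simp
    show "b (Suc n) = r (n div 2) * b n" for n by (simp add: b_def)
    show "mono (\<lambda>k. r (k div 2))" by (intro monoI monoD[OF r(1)] div_le_mono)
    show "\<not> summable (\<lambda>k. 1 / r (k div 2))"
    proof
      assume "summable (\<lambda>k. 1 / r (k div 2))"
      hence "summable ((\<lambda>k. 1 / r (k div 2)) \<circ> (\<lambda>k. 2 * k))"
        by (rule summable_reindex) (use r(2) in \<open>auto simp: inj_def less_imp_le\<close>)
      with r(3) show False by (simp add: o_def)
    qed
  qed (use r(2) zero that in auto)
  interpret M: prob_space M by fact
  have space: "space N = UNIV" using N(1) sets_eq_imp_space_eq[of N borel] by (simp add: halfline_measure_def)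
  have "prob_space N"
  proof (rule prob_spaceI)
    have "integrable N (\<lambda>x. x ^ 0)" using N(2) unfolding finite_moments_def by blast
    hence "emeasure N (space N) < \<infinity>" by (simp add: integrable_iff_bounded)
    moreover have "measure N (space N) = 1" using eq[rule_format, of 0] by (simp add: M.prob_space)
    ultimately show "emeasure N (space N) = 1" by (simp add: emeasure_eq_ennreal_measure)
  qed
  moreover have "(\<integral>x. cos (t * sqrt x) \<partial>N) = (\<integral>x. cos (t * sqrt x) \<partial>M)" if "t \<ge> 0" for t
    using F0[OF that] by (simp add: F_def J_def)
  ultimately show "N = M" using N M by (intro halfline_prob_eqI)
qed (use M in auto)

subsection \<open>Densities of order \<open>exp (- \<alpha> * sqrt x / ln x)\<close>\<close>

lemma ln_power_le_prod_ln: "ln (real n + 2) ^ n \<le> exp (real n) * (\<Prod>k<n. ln (real k + 3))"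
proof (induction n)
  case (Suc n)
  have "ln (real n + 3) \<le> ln (real n + 2) * (1 + 1 / (real n + 1))"
  proof -
    have "ln (1 / (real n + 2)) \<le> 1 / (real n + 2) - 1" by (rule ln_le_minus_one) auto
    hence L: "(real n + 1) / (real n + 2) \<le> ln (real n + 2)" by (simp add: ln_div field_simps)
    have "ln (real n + 3) - ln (real n + 2) = ln ((real n + 3) / (real n + 2))" by (simp add: ln_div)
    also have "\<dots> \<le> (real n + 3) / (real n + 2) - 1" by (rule ln_le_minus_one) auto
    also have "\<dots> = (real n + 1) / (real n + 2) / (real n + 1)" by (simp add: divide_simps)
    also have "\<dots> \<le> ln (real n + 2) / (real n + 1)" by (intro divide_right_mono L) auto
    finally show ?thesis by (simp add: algebra_simps)
  qed
  hence "ln (real n + 3) ^ n \<le> (ln (real n + 2) * (1 + 1 / (real n + 1))) ^ n"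
    by (intro power_mono) auto
  also have "\<dots> = ln (real n + 2) ^ n * (1 + 1 / (real n + 1)) ^ n" by (rule power_mult_distrib)
  also have "\<dots> \<le> ln (real n + 2) ^ n * exp 1"
  proof (rule mult_left_mono)
    have "(1 + 1 / (real n + 1)) ^ n \<le> exp (1 / (real n + 1)) ^ n"
      by (intro power_mono exp_ge_add_one_self) auto
    also have "\<dots> = exp (real n * (1 / (real n + 1)))" by (simp add: exp_of_nat_mult[symmetric])
    also have "\<dots> \<le> exp 1" by (simp add: field_simps)
    finally show "(1 + 1 / (real n + 1)) ^ n \<le> exp 1" .
  qed auto
  also have "\<dots> \<le> (exp (real n) * (\<Prod>k<n. ln (real k + 3))) * exp 1"
    by (intro mult_right_mono Suc.IH) auto
  finally have "ln (real n + 3) * ln (real n + 3) ^ n \<le> ln (real n + 3) * ((exp (real n) * (\<Prod>k<n. ln (real k + 3))) * exp 1)"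
    by (intro mult_left_mono) auto
  thus ?case by (simp add: exp_add mult_ac add_ac)
qed simp

lemma power_le_fact_exp: "x ^ n \<le> fact n * exp x" if "x \<ge> (0::real)"
proof -
  have "x ^ n / fact n = (\<Sum>i\<in>{n}. x ^ i / fact i)" by simp
  also have "\<dots> \<le> (\<Sum>i. x ^ i / fact i)"
    using summable_exp_generic[of x] that by (intro sum_le_suminf) (auto simp: field_simps)
  also have "\<dots> = exp x" by (simp add: exp_def field_simps)
  finally show ?thesis by (simp add: field_simps)
qed

lemma ln_Suc3_ge_1: "1 \<le> ln (real k + 3)"
proof -
  have "exp 1 \<le> real k + 3" using exp_le by linarith
  thus ?thesis by (subst ln_ge_iff) auto
qed

lemma power_le_log_factorial_exp:
  fixes \<gamma> B :: real
  assumes \<gamma>: "\<gamma> > 0"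
  obtains A where "A \<ge> 1" "A \<ge> B"
    "\<And>y n. y \<ge> A \<Longrightarrow> y ^ n \<le> (\<Prod>k<n. A * (real k + 1) * ln (real k + 3)) * exp (\<gamma> * y / ln y)"
proof -
  have "eventually (\<lambda>y. sqrt y * ln y \<le> \<gamma> * y / ln y) at_top" using \<gamma> by real_asymp
  then obtain y0 where y0: "\<And>y. y \<ge> y0 \<Longrightarrow> sqrt y * ln y \<le> \<gamma> * y / ln y"
    by (auto simp: eventually_at_top_linorder)
  define A where "A = Max {2, B, y0, 2 * exp 1 / \<gamma>}"
  have A: "A \<ge> 2" "A \<ge> B" "A \<ge> y0" "A \<ge> 2 * exp 1 / \<gamma>" by (auto simp: A_def)
  show ?thesis
  proof (rule that)
    show "A \<ge> 1" "A \<ge> B" using A by auto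
    fix y :: real and n :: nat assume y: "y \<ge> A"
    have prod: "(\<Prod>k<n. A * (real k + 1) * ln (real k + 3)) = A ^ n * fact n * (\<Prod>k<n. ln (real k + 3))"
      by (induction n) (simp_all add: algebra_simps)
    show "y ^ n \<le> (\<Prod>k<n. A * (real k + 1) * ln (real k + 3)) * exp (\<gamma> * y / ln y)"
    \<comment> \<open>Below \<open>(n + 2)\<^sup>2\<close> the factor \<open>ln y\<close> is at most \<open>2 * ln (n + 2)\<close>; above it, \<open>y ^ n \<le> exp (sqrt y * ln y)\<close>.\<close>
    proof (cases "y \<le> (real n + 2)\<^sup>2")
      case True
      define L where "L = ln (real n + 2)"
      have L: "L > 0" by (simp add: L_def)
      have "ln y \<le> ln ((real n + 2)\<^sup>2)" using True y A by (subst ln_le_cancel_iff) auto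
      hence lny: "ln y \<le> 2 * L" by (simp add: L_def ln_realpow)
      have "y ^ n = (2 / \<gamma>) ^ n * L ^ n * (\<gamma> * y / (2 * L)) ^ n"
        using \<gamma> L by (simp flip: power_mult_distrib)
      also have "\<dots> \<le> (2 / \<gamma>) ^ n * L ^ n * (fact n * exp (\<gamma> * y / (2 * L)))"
        using \<gamma> L y A by (intro mult_left_mono power_le_fact_exp) auto
      also have "\<dots> \<le> (2 / \<gamma>) ^ n * (exp (real n) * (\<Prod>k<n. ln (real k + 3))) * (fact n * exp (\<gamma> * y / ln y))"
        unfolding L_def
      proof (intro mult_mono mult_left_mono ln_power_le_prod_ln)
        have "\<gamma> * y / (2 * L) \<le> \<gamma> * y / ln y"
          using lny \<gamma> y A by (intro divide_left_mono mult_pos_pos L) auto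
        thus "exp (\<gamma> * y / (2 * ln (real n + 2))) \<le> exp (\<gamma> * y / ln y)" by (simp add: L_def)
      qed (use \<gamma> in \<open>auto intro!: mult_nonneg_nonneg prod_nonneg\<close>)
      also have "\<dots> = (2 * exp 1 / \<gamma>) ^ n * (fact n * (\<Prod>k<n. ln (real k + 3)) * exp (\<gamma> * y / ln y))"
        by (simp add: power_mult_distrib power_divide exp_of_nat_mult[symmetric])
      also have "\<dots> \<le> A ^ n * (fact n * (\<Prod>k<n. ln (real k + 3)) * exp (\<gamma> * y / ln y))"
        using A \<gamma> by (intro mult_right_mono power_mono) (auto intro!: mult_nonneg_nonneg prod_nonneg)
      finally show ?thesis unfolding prod by (simp only: mult_ac)
    next
      case False
      hence "real n \<le> sqrt y" by (intro real_le_rsqrt) (auto simp: power2_eq_square algebra_simps)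
      hence "real n * ln y \<le> sqrt y * ln y" using y A by (intro mult_right_mono) auto
      also have "\<dots> \<le> \<gamma> * y / ln y" using y A by (intro y0) auto
      finally have "exp (real n * ln y) \<le> exp (\<gamma> * y / ln y)" by simp
      moreover have "exp (real n * ln y) = y ^ n" using y A by (simp add: exp_of_nat_mult)
      moreover have "1 \<le> (\<Prod>k<n. A * (real k + 1) * ln (real k + 3))"
        using A by (intro prod_ge_1 mult_ge1_I ln_Suc3_ge_1) auto
      ultimately have "1 * y ^ n \<le> (\<Prod>k<n. A * (real k + 1) * ln (real k + 3)) * exp (\<gamma> * y / ln y)"
        using y A by (intro mult_mono) auto
      thus ?thesis by simp
    qed
  qed
qed

lemma not_summable_inverse_n_ln:
  assumes "A > 0"
  shows "\<not> summable (\<lambda>k. 1 / (A * (real k + 1) * ln (real k + 3)))"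
proof
  assume "summable (\<lambda>k. 1 / (A * (real k + 1) * ln (real k + 3)))"
  hence "summable (\<lambda>k. A * (1 / (A * (real k + 1) * ln (real k + 3))))" by (rule summable_mult)
  hence sm: "summable (\<lambda>k. 1 / ((real k + 1) * ln (real k + 3)))" using assms by simp
  define f where "f = (\<lambda>k::nat. ln (ln (real k + 3)))"
  have "summable (\<lambda>k. f (Suc k) - f k)"
  proof (rule summable_comparison_test'[OF sm])
    fix k :: nat
    define L where "L = ln (real k + 3)"
    have L: "L \<ge> 1" unfolding L_def by (rule ln_Suc3_ge_1)
    have L': "ln (real k + 4) \<ge> L" by (simp add: L_def)
    have f: "f k = ln L" "f (Suc k) = ln (ln (real k + 4))" by (simp_all add: f_def L_def add_ac)
    have "f (Suc k) - f k = ln (ln (real k + 4) / L)" using L L' by (simp add: f ln_div)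
    also have "\<dots> \<le> ln (real k + 4) / L - 1" using L L' by (intro ln_le_minus_one) auto
    also have "\<dots> = (ln (real k + 4) - L) / L" using L by (simp add: field_simps)
    also have "\<dots> \<le> (1 / (real k + 1)) / L"
    proof (rule divide_right_mono)
      have "ln (real k + 4) - L = ln ((real k + 4) / (real k + 3))" by (simp add: L_def ln_div)
      also have "\<dots> \<le> (real k + 4) / (real k + 3) - 1" by (rule ln_le_minus_one) auto
      also have "\<dots> \<le> 1 / (real k + 1)" by (simp add: field_simps)
      finally show "ln (real k + 4) - L \<le> 1 / (real k + 1)" .
    qed (use L in auto)
    finally have "f (Suc k) - f k \<le> 1 / ((real k + 1) * ln (real k + 3))" by (simp add: L_def)
    moreover have "f (Suc k) - f k \<ge> 0" using L L' by (simp add: f)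
    ultimately show "norm (f (Suc k) - f k) \<le> 1 / ((real k + 1) * ln (real k + 3))" by simp
  qed
  hence "convergent (\<lambda>n. f n - f 0)" by (simp add: summable_iff_convergent sum_lessThan_telescope)
  moreover have "filterlim (\<lambda>n. f n - f 0) at_top sequentially" unfolding f_def by real_asymp
  hence "filterlim (\<lambda>n. f n - f 0) at_infinity sequentially" by (rule filterlim_at_top_imp_at_infinity)
  ultimately show False
    by (auto simp: convergent_def dest: not_tendsto_and_filterlim_at_infinity[OF sequentially_bot])
qed

lemma log_exp_moment_determinate:
  fixes \<beta> x0 :: real
  assumes M: "prob_space M" "halfline_measure M" "finite_moments M" and \<beta>: "\<beta> > 0"
    and int: "integrable M (\<lambda>x. indicator {x0..} x * exp (\<beta> * sqrt x / ln x))"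
  shows "moment_determinate M"
proof -
  interpret M: prob_space M by fact
  obtain A where A: "A \<ge> 1" "A \<ge> sqrt \<bar>x0\<bar>" and
    bound: "\<And>y n. y \<ge> A \<Longrightarrow> y ^ n \<le> (\<Prod>k<n. A * (real k + 1) * ln (real k + 3)) * exp (\<beta> / 4 * y / ln y)"
    using power_le_log_factorial_exp[of "\<beta> / 4" "sqrt \<bar>x0\<bar>"] \<beta> by auto
  define r where "r = (\<lambda>k. A * (real k + 1) * ln (real k + 3))"
  define G where "G = (\<lambda>x. indicator {x0..} x * exp (\<beta> * sqrt x / ln x))"
  have r1: "A \<le> r k" for k
  proof -
    have "A * 1 * 1 \<le> A * (real k + 1) * ln (real k + 3)"
      using A ln_Suc3_ge_1[of k] by (intro mult_mono) auto
    thus ?thesis by (simp add: r_def)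
  qed
  have pointwise: "x ^ n \<le> (\<Prod>k<n. (r k)\<^sup>2) * (1 + G x)" if x: "x \<ge> 0" for x n
  proof -
    have "(sqrt x ^ n)\<^sup>2 = ((sqrt x)\<^sup>2) ^ n" by (simp only: power_mult[symmetric] mult.commute)
    hence sq: "x ^ n = (sqrt x ^ n)\<^sup>2" using x by simp
    have sqp: "(\<Prod>k<n. (r k)\<^sup>2) = (\<Prod>k<n. r k)\<^sup>2" by (simp add: prod_power_distrib)
    have G0: "G x \<ge> 0" by (simp add: G_def)
    show ?thesis
    proof (cases "sqrt x \<ge> A")
      case True
      have "sqrt \<bar>x0\<bar> \<le> sqrt x" using True A by linarith
      hence G: "G x = exp (\<beta> * sqrt x / ln x)" by (simp add: G_def)
      have "x > 0" using True A by (metis less_le_trans not_less real_sqrt_gt_0_iff zero_less_one)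
      hence e: "\<beta> / 4 * sqrt x / ln (sqrt x) * 2 = \<beta> * sqrt x / ln x"
        by (simp add: ln_sqrt)
      have "x ^ n \<le> ((\<Prod>k<n. r k) * exp (\<beta> / 4 * sqrt x / ln (sqrt x)))\<^sup>2"
        unfolding sq using bound[OF True, of n] x by (intro power_mono) (auto simp: r_def)
      also have "\<dots> = (\<Prod>k<n. (r k)\<^sup>2) * exp (\<beta> / 4 * sqrt x / ln (sqrt x) * 2)"
        unfolding sqp power_mult_distrib by (simp add: power2_eq_square flip: exp_add)
      also have "\<dots> = (\<Prod>k<n. (r k)\<^sup>2) * G x" unfolding e G ..
      also have "\<dots> \<le> (\<Prod>k<n. (r k)\<^sup>2) * (1 + G x)"
        by (intro mult_left_mono prod_nonneg) auto
      finally show ?thesis .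
    next
      case False
      have "sqrt x ^ n \<le> A ^ n" using False x by (intro power_mono) auto
      also have "\<dots> = (\<Prod>k<n. A)" by simp
      also have "\<dots> \<le> (\<Prod>k<n. r k)" using A r1 by (intro prod_mono) auto
      finally have "x ^ n \<le> (\<Prod>k<n. (r k)\<^sup>2)"
        unfolding sq sqp using x by (intro power_mono) auto
      also have "\<dots> \<le> (\<Prod>k<n. (r k)\<^sup>2) * (1 + G x)"
        using G0 by (simp add: mult_left_le prod_nonneg distrib_left)
      finally show ?thesis .
    qed
  qed
  show ?thesis
  proof (rule carleman_moment_determinate[OF M])
    show "r k > 0" for k using r1[of k] A by linarith
    show "mono r" unfolding r_def using A
      by (intro monoI mult_mono) auto
    show "\<not> summable (\<lambda>k. 1 / r k)" unfolding r_def
      by (rule not_summable_inverse_n_ln) (use A in auto)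
    fix n
    have "(\<integral>x. x ^ n \<partial>M) \<le> (\<integral>x. (\<Prod>k<n. (r k)\<^sup>2) * (1 + G x) \<partial>M)"
    proof (rule integral_mono_AE)
      show "AE x in M. x ^ n \<le> (\<Prod>k<n. (r k)\<^sup>2) * (1 + G x)"
        using halfline_AE_nonneg[OF M(2)] by eventually_elim (rule pointwise)
    qed (use M(3) int in \<open>auto simp: finite_moments_def G_def\<close>)
    thus "(\<integral>x. x ^ n \<partial>M) \<le> (\<integral>x. 1 + G x \<partial>M) * (\<Prod>k<n. (r k)\<^sup>2)" by (simp add: mult.commute)
  qed
qed

lemma density_log_exp_determinate:
  fixes f :: "real \<Rightarrow> real" and \<alpha> :: real
  assumes M: "prob_space M" "halfline_measure M" "finite_moments M"
    and f: "f \<in> borel_measurable borel" "\<And>x. f x \<ge> 0" "M = density lborel (\<lambda>x. ennreal (f x))"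
    and \<alpha>: "\<alpha> > 0" and O: "f \<in> O[at_top](\<lambda>x. exp (- (\<alpha> * sqrt x / ln x)))"
  shows "moment_determinate M"
proof -
  obtain K where K: "K > 0" "eventually (\<lambda>x. norm (f x) \<le> K * norm (exp (- (\<alpha> * sqrt x / ln x)))) at_top"
    using O by (auto elim: landau_o.bigE)
  have "eventually (\<lambda>x. exp (- (\<alpha> / 2 * sqrt x / ln x)) \<le> 1 / x ^ 2) at_top" using \<alpha> by real_asymp
  with K(2) eventually_ge_at_top[of 1] have "eventually (\<lambda>x. exp (\<alpha> / 2 * sqrt x / ln x) * f x \<le> K / x\<^sup>2 \<and> x \<ge> 1) at_top"
  proof eventually_elim
    case (elim x)
    have "exp (\<alpha> / 2 * sqrt x / ln x) * f x \<le> exp (\<alpha> / 2 * sqrt x / ln x) * (K * exp (- (\<alpha> * sqrt x / ln x)))"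
      using elim by (intro mult_left_mono) auto
    also have "\<dots> = K * exp (- (\<alpha> / 2 * sqrt x / ln x))" by (simp flip: exp_add)
    also have "\<dots> \<le> K * (1 / x\<^sup>2)" using elim K by (intro mult_left_mono) auto
    finally show ?case using elim by simp
  qed
  then obtain x0 where x0: "\<And>x. x \<ge> x0 \<Longrightarrow> exp (\<alpha> / 2 * sqrt x / ln x) * f x \<le> K / x\<^sup>2 \<and> x \<ge> 1"
    by (auto simp: eventually_at_top_linorder)
  have x0_1: "x0 \<ge> 1" using x0[of x0] by simp
  have "(\<integral>\<^sup>+x. ennreal (K / x\<^sup>2) * indicator {x0..} x \<partial>lborel) = ennreal (0 - (- K / x0))"
  proof (rule nn_integral_FTC_atLeast)
    show "((\<lambda>x. - K / x) \<longlongrightarrow> 0) at_top" by real_asymp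
    fix x assume x: "x0 \<le> x"
    with x0_1 show "((\<lambda>x. - K / x) has_real_derivative K / x\<^sup>2) (at x)"
      by (auto intro!: derivative_eq_intros simp: power2_eq_square)
    show "0 \<le> K / x\<^sup>2" using K by simp
  qed measurable
  hence fin: "(\<integral>\<^sup>+x. ennreal (K / x\<^sup>2) * indicator {x0..} x \<partial>lborel) < \<infinity>" by simp
  have "integrable M (\<lambda>x. indicator {x0..} x * exp (\<alpha> / 2 * sqrt x / ln x))"
  proof (rule integrableI_nonneg)
    note [measurable] = f(1)
    have [measurable_cong]: "sets M = sets borel" using f(3) by simp
    show "(\<lambda>x. indicator {x0..} x * exp (\<alpha> / 2 * sqrt x / ln x)) \<in> borel_measurable M" by measurable
    have "(\<integral>\<^sup>+x. ennreal (indicator {x0..} x * exp (\<alpha> / 2 * sqrt x / ln x)) \<partial>M)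
       = (\<integral>\<^sup>+x. ennreal (f x) * ennreal (indicator {x0..} x * exp (\<alpha> / 2 * sqrt x / ln x)) \<partial>lborel)"
      unfolding f(3) by (rule nn_integral_density) auto
    also have "\<dots> \<le> (\<integral>\<^sup>+x. ennreal (K / x\<^sup>2) * indicator {x0..} x \<partial>lborel)"
      using x0 f(2) by (intro nn_integral_mono) (auto simp: indicator_def mult.commute intro!: ennreal_leI simp flip: ennreal_mult')
    also note fin
    finally show "(\<integral>\<^sup>+x. ennreal (indicator {x0..} x * exp (\<alpha> / 2 * sqrt x / ln x)) \<partial>M) < \<infinity>" .
  qed auto
  thus ?thesis using \<alpha> by (intro log_exp_moment_determinate[OF M, of "\<alpha> / 2" x0]) auto
qed

lemma density_not_exp_sqrt_integrable:
  fixes f :: "real \<Rightarrow> real" and \<alpha> c :: real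
  assumes f: "f \<in> borel_measurable borel" "\<And>x. f x \<ge> 0"
    and c: "c > 0" and Om: "f \<in> \<Omega>[at_top](\<lambda>x. exp (- (\<alpha> * sqrt x / ln x)))"
  shows "(\<integral>\<^sup>+x\<in>{0..}. ennreal (exp (c * sqrt x) * f x) \<partial>lborel) = \<infinity>"
proof -
  obtain k where k: "k > 0" "eventually (\<lambda>x. norm (f x) \<ge> k * norm (exp (- (\<alpha> * sqrt x / ln x)))) at_top"
    using Om by (rule landau_omega.bigE)
  have "filterlim (\<lambda>x. c * sqrt x - \<alpha> * sqrt x / ln x) at_top at_top" using c by real_asymp
  hence "eventually (\<lambda>x. c * sqrt x - \<alpha> * sqrt x / ln x \<ge> 0) at_top"
    unfolding filterlim_at_top by blast
  with k(2) eventually_ge_at_top[of 0] have "eventually (\<lambda>x. exp (c * sqrt x) * f x \<ge> k \<and> x \<ge> 0) at_top"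
  proof eventually_elim
    case (elim x)
    have "k * 1 \<le> k * exp (c * sqrt x - \<alpha> * sqrt x / ln x)" using elim k by (intro mult_left_mono) auto
    also have "\<dots> = exp (c * sqrt x) * (k * exp (- (\<alpha> * sqrt x / ln x)))" by (simp flip: exp_add)
    also have "\<dots> \<le> exp (c * sqrt x) * f x" using elim f(2)[of x] by (intro mult_left_mono) auto
    finally show ?case using elim by simp
  qed
  then obtain x0 where x0: "\<And>x. x \<ge> x0 \<Longrightarrow> exp (c * sqrt x) * f x \<ge> k \<and> x \<ge> 0"
    by (auto simp: eventually_at_top_linorder)
  have inf: "emeasure lborel {x0..} = \<infinity>"
  proof -
    have "(SUP n. of_nat n) \<le> emeasure lborel {x0..}"
    proof (rule SUP_least)
      fix n :: nat
      have "of_nat n = emeasure lborel {x0..x0 + real n}" by (simp add: ennreal_of_nat_eq_real_of_nat)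
      also have "\<dots> \<le> emeasure lborel {x0..}" by (rule emeasure_mono) auto
      finally show "of_nat n \<le> emeasure lborel {x0..}" .
    qed
    thus ?thesis by (simp add: ennreal_SUP_of_nat_eq_top top_unique)
  qed
  have "\<infinity> = ennreal k * emeasure lborel {x0..}" using k(1) by (simp add: inf ennreal_mult_top)
  also have "\<dots> = (\<integral>\<^sup>+x\<in>{x0..}. ennreal k \<partial>lborel)" by (simp add: nn_integral_cmult_indicator)
  also have "\<dots> \<le> (\<integral>\<^sup>+x\<in>{0..}. ennreal (exp (c * sqrt x) * f x) \<partial>lborel)"
    using x0 by (intro nn_integral_mono) (auto simp: indicator_def intro!: ennreal_leI)
  finally show ?thesis by (simp add: top_unique)
qed

subsection \<open>Hardy's condition\<close>

lemma tail_bigo_of_hardy: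
  assumes "prob_space M" "sets M = sets borel" and c: "c > 0"
    and fin: "(\<integral>\<^sup>+x\<in>{0..}. ennreal (exp (c * sqrt x)) \<partial>M) < \<infinity>"
  shows "tail M \<in> O[at_top](\<lambda>x. exp (- c * sqrt x))"
proof -
  interpret prob_space M by fact
  note [measurable_cong] = assms(2)
  define I where "I = enn2real (\<integral>\<^sup>+x\<in>{0..}. ennreal (exp (c * sqrt x)) \<partial>M)"
  have I: "(\<integral>\<^sup>+x\<in>{0..}. ennreal (exp (c * sqrt x)) \<partial>M) = ennreal I"
    unfolding I_def using fin by (simp add: less_top)
  have I0: "I \<ge> 0" by (simp add: I_def)
  have "tail M x \<le> I * exp (- c * sqrt x)" if x: "x \<ge> 0" for x
  proof -
    have "ennreal (exp (c * sqrt x) * tail M x) = ennreal (exp (c * sqrt x)) * emeasure M {x..}"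
      by (simp add: tail_def emeasure_eq_measure ennreal_mult')
    also have "\<dots> = (\<integral>\<^sup>+y\<in>{x..}. ennreal (exp (c * sqrt x)) \<partial>M)"
      by (simp add: nn_integral_cmult_indicator)
    also have "\<dots> \<le> (\<integral>\<^sup>+y\<in>{0..}. ennreal (exp (c * sqrt y)) \<partial>M)"
      using c x by (intro nn_integral_mono) (auto simp: indicator_def intro!: ennreal_leI)
    also note I
    finally have "exp (c * sqrt x) * tail M x \<le> I" using I0 by simp
    thus ?thesis by (simp add: exp_minus field_simps)
  qed
  thus ?thesis
    by (intro bigoI[of _ I] eventually_mono[OF eventually_ge_at_top[of 0]]) (simp add: tail_def)
qed

lemma hardy_of_tail_bigo:
  assumes "prob_space M" "sets M = sets borel" and c: "c > 0"
    and O: "tail M \<in> O[at_top](\<lambda>x. exp (- c * sqrt x))"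
  shows "(\<integral>\<^sup>+x\<in>{0..}. ennreal (exp (c / 2 * sqrt x)) \<partial>M) < \<infinity>"
proof -
  interpret prob_space M by fact
  note [measurable_cong] = assms(2)
  define u where "u = (\<lambda>n::nat. exp (c / 2 * sqrt (real n + 1)) * tail M (real n))"
  have "(\<integral>\<^sup>+x\<in>{0..}. ennreal (exp (c / 2 * sqrt x)) \<partial>M)
      \<le> (\<integral>\<^sup>+x. (\<Sum>n. ennreal (exp (c / 2 * sqrt (real n + 1))) * indicator {real n..} x) \<partial>M)"
  proof (rule nn_integral_mono)
    fix x
    show "ennreal (exp (c / 2 * sqrt x)) * indicator {0..} x
      \<le> (\<Sum>n. ennreal (exp (c / 2 * sqrt (real n + 1))) * indicator {real n..} x)"
    proof (cases "x \<ge> 0")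
      case True
      define m where "m = nat \<lfloor>x\<rfloor>"
      have m: "real m \<le> x" "x \<le> real m + 1" using True by (auto simp: m_def)
      have "ennreal (exp (c / 2 * sqrt x)) * indicator {0..} x
        \<le> (\<Sum>n\<in>{m}. ennreal (exp (c / 2 * sqrt (real n + 1))) * indicator {real n..} x)"
        using m c True by (auto intro!: ennreal_leI)
      also have "\<dots> \<le> (\<Sum>n. ennreal (exp (c / 2 * sqrt (real n + 1))) * indicator {real n..} x)"
        by (rule sum_le_suminf) auto
      finally show ?thesis .
    qed auto
  qed
  also have "\<dots> = (\<Sum>n. ennreal (exp (c / 2 * sqrt (real n + 1))) * emeasure M {real n..})"
    by (subst nn_integral_suminf) (auto simp: nn_integral_cmult_indicator)
  also have "\<dots> = (\<Sum>n. ennreal (u n))"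
    by (simp add: u_def tail_def emeasure_eq_measure ennreal_mult')
  also have "\<dots> < \<infinity>"
  proof -
    obtain K where K: "K > 0" "eventually (\<lambda>x. norm (tail M x) \<le> K * norm (exp (- c * sqrt x))) at_top"
      using O by (auto elim: landau_o.bigE)
    have ev: "eventually (\<lambda>n::nat. norm (tail M (real n)) \<le> K * norm (exp (- c * sqrt (real n)))) sequentially"
      using eventually_compose_filterlim[OF K(2) filterlim_real_sequentially] .
    have "eventually (\<lambda>n::nat. exp (c / 2 * sqrt (real n + 1)) * exp (- c * sqrt (real n)) \<le> 1 / real n ^ 2) sequentially"
      using c by real_asymp
    with ev have "eventually (\<lambda>n. norm (u n) \<le> K * (1 / real n ^ 2)) sequentially"
    proof eventually_elim
      case (elim n)
      have "norm (u n) = exp (c / 2 * sqrt (real n + 1)) * tail M (real n)"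
        by (simp add: u_def tail_def)
      also have "\<dots> \<le> exp (c / 2 * sqrt (real n + 1)) * (K * exp (- c * sqrt (real n)))"
        using elim by (intro mult_left_mono) auto
      also have "\<dots> = K * (exp (c / 2 * sqrt (real n + 1)) * exp (- c * sqrt (real n)))" by simp
      also have "\<dots> \<le> K * (1 / real n ^ 2)" using elim K by (intro mult_left_mono) auto
      finally show ?case .
    qed
    hence "summable u"
      by (rule summable_comparison_test_ev)
         (intro summable_mult, use inverse_power_summable[of 2, where ?'a = real] in \<open>simp add: divide_simps inverse_eq_divide\<close>)
    moreover have "u n \<ge> 0" for n by (simp add: u_def tail_def)
    ultimately show ?thesis by (simp add: suminf_ennreal2 less_top)
  qed
  finally show ?thesis .
qed

lemma deriv_const_exp_half: "deriv (\<lambda>x. c * exp (x / 2)) = (\<lambda>x::real. c / 2 * exp (x / 2))"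
  by (rule ext, rule DERIV_imp_deriv) (auto intro!: derivative_eq_intros)

lemma const_exp_half_asymptotically_parabolic_D:
  fixes c :: real
  assumes c: "c > 0"
  shows "(\<lambda>x. c * exp (x / 2)) \<in> asymptotically_parabolic_D"
proof -
  let ?G = "\<lambda>x::real. c * exp (x / 2)"
  have D: "deriv (deriv ?G) = (\<lambda>x. c / 4 * exp (x / 2))"
    unfolding deriv_const_exp_half using deriv_const_exp_half[of "c / 2"] by simp
  define s where "s = (\<lambda>u. (c / 4 * exp (u / 2)) powr (-1/2))"
  have s: "(s \<longlongrightarrow> 0) at_top" unfolding s_def using c by real_asymp
  have C2: "?G \<in> C2_plus {x. -\<infinity> < ereal x}"
    unfolding C2_plus_def
    by (intro CollectI exI[of _ "\<lambda>x. c / 2 * exp (x / 2)"] exI[of _ "\<lambda>x. c / 4 * exp (x / 2)"])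
       (use c in \<open>auto intro!: derivative_eq_intros continuous_intros\<close>)
  have "uniform_limit K (\<lambda>u w. deriv (deriv ?G) (u + w * deriv (deriv ?G) u powr (-1/2)) / deriv (deriv ?G) u)
          (\<lambda>w. 1) at_top" if K: "compact K" for K :: "real set"
  proof -
    have eq: "deriv (deriv ?G) (u + w * deriv (deriv ?G) u powr (-1/2)) / deriv (deriv ?G) u = exp (w * s u / 2)" for u w
      using c by (simp add: D s_def add_divide_distrib exp_add)
    obtain R where R: "R > 0" "\<And>w. w \<in> K \<Longrightarrow> \<bar>w\<bar> \<le> R"
      using compact_imp_bounded[OF K] by (auto simp: bounded_pos)
    have "((\<lambda>u. exp (R * s u / 2) - 1) \<longlongrightarrow> exp (R * 0 / 2) - 1) at_top" by (intro tendsto_intros s) auto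
    hence lim: "((\<lambda>u. exp (R * s u / 2) - 1) \<longlongrightarrow> 0) at_top" by simp
    show ?thesis unfolding eq
    proof (rule uniform_limitI)
      fix e :: real assume "e > 0"
      from order_tendstoD(2)[OF lim this]
      show "eventually (\<lambda>u. \<forall>w\<in>K. dist (exp (w * s u / 2)) 1 < e) at_top"
      proof eventually_elim
        case (elim u)
        show ?case
        proof
          fix w assume "w \<in> K"
          have s0: "s u \<ge> 0" by (simp add: s_def)
          define d where "d = R * s u / 2"
          have "\<bar>w * s u / 2\<bar> \<le> d"
            using R(2)[OF \<open>w \<in> K\<close>] s0 by (simp add: abs_mult d_def mult_right_mono)
          hence *: "- d \<le> w * s u / 2" "w * s u / 2 \<le> d" by linarith+
          have "exp (w * s u / 2) \<le> exp d" using * by simp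
          moreover have "1 - exp (w * s u / 2) \<le> exp d - 1"
          proof -
            have "exp (- d) \<le> exp (w * s u / 2)" using * by simp
            moreover have "exp d + exp (- d) \<ge> 2"
              using exp_ge_add_one_self[of d] exp_ge_add_one_self[of "-d"] by linarith
            ultimately show ?thesis by linarith
          qed
          moreover have "exp d - 1 < e" using elim by (simp add: d_def)
          ultimately show "dist (exp (w * s u / 2)) 1 < e"
            unfolding dist_real_def by linarith
        qed
      qed
    qed
  qed
  with C2 have "?G \<in> asymptotically_parabolic"
    unfolding asymptotically_parabolic_def by (intro CollectI exI[of _ "-\<infinity>"]) auto
  moreover have "filterlim (\<lambda>x. ?G x / x) at_top at_top" using c by real_asymp
  ultimately show ?thesis by (simp add: asymptotically_parabolic_D_def)
qed

lemma suminf_exp_half_inv_deriv_const_exp_half: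
  fixes c :: real
  assumes c: "c > 0"
  shows "strict_mono (deriv (\<lambda>x. c * exp (x / 2)))"
    and "n \<ge> 1 \<Longrightarrow> real n \<in> range (deriv (\<lambda>x. c * exp (x / 2)))"
    and "(\<Sum>n. ennreal (exp (- (1/2) * inv (deriv (\<lambda>x. c * exp (x / 2))) (real (n + 1))))) = \<infinity>"
proof -
  let ?d = "deriv (\<lambda>x. c * exp (x / 2))"
  show mono: "strict_mono ?d" unfolding deriv_const_exp_half using c by (auto simp: strict_mono_def)
  have val: "?d (2 * ln (2 * y / c)) = y" if "y > 0" for y
    using that c by (simp add: deriv_const_exp_half)
  show "real n \<in> range ?d" if "n \<ge> 1" using val[of "real n"] that by (metis rangeI of_nat_0_less_iff less_le_trans zero_less_one)
  have inv: "inv ?d y = 2 * ln (2 * y / c)" if "y > 0" for y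
    using inv_f_f[OF strict_mono_imp_inj_on[OF mono], of "2 * ln (2 * y / c)"] val[OF that] by simp
  have eq: "exp (- (1/2) * inv ?d (real (n + 1))) = c / 2 * (1 / real (Suc n))" for n
    using c by (simp add: inv exp_minus field_simps)
  have "\<not> summable (\<lambda>n. c / 2 * (1 / real (Suc n)))"
  proof
    assume "summable (\<lambda>n. c / 2 * (1 / real (Suc n)))"
    hence "summable (\<lambda>n. 2 / c * (c / 2 * (1 / real (Suc n))))" by (rule summable_mult)
    moreover have "2 / c * (c / 2 * (1 / real (Suc n))) = inverse (real (Suc n))" for n
      using c by (simp add: field_simps)
    ultimately have "summable (\<lambda>n. inverse (real (Suc n)))" by simp
    thus False using not_summable_harmonic[where ?'a = real] summable_Suc_iff[of "\<lambda>n. inverse (real n)"] by simp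
  qed
  moreover have "0 \<le> c / 2 * (1 / real (Suc n))" for n using c by simp
  ultimately have "(\<Sum>n. ennreal (c / 2 * (1 / real (Suc n)))) = \<infinity>"
    using summable_suminf_not_top[of "\<lambda>n. c / 2 * (1 / real (Suc n))"] by (metis infinity_ennreal_def)
  thus "(\<Sum>n. ennreal (exp (- (1/2) * inv ?d (real (n + 1))))) = \<infinity>" unfolding eq .
qed

theorem corollary1p2:
  fixes \<nu> :: "real measure"
  assumes "prob_space \<nu>"
    and "halfline_measure \<nu>"
    and "\<not> bounded (measure_support \<nu>)"
    and "finite_moments \<nu>"
  shows
    "(hardy_condition \<nu> \<longleftrightarrow> (\<exists>c>0. tail \<nu> \<in> O[at_top](\<lambda>x. exp (- c * sqrt x)))) \<and>
     (hardy_condition \<nu> \<longrightarrow>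
        (\<exists>c>0. \<exists>G. G = (\<lambda>x::real. c * exp (x / 2)) \<and>
           G \<in> asymptotically_parabolic_D \<and>
           tail \<nu> \<in> O[at_top](\<lambda>x. exp (- G (ln x))) \<and>
           strict_mono (deriv G) \<and>
           (\<exists>N\<ge>1. (\<forall>n\<ge>N. real n \<in> range (deriv G)) \<and>
                  (\<Sum>n. ennreal (exp (- (1/2) * inv (deriv G) (real (n + N))))) = \<infinity>))) \<and>
     (\<forall>f \<alpha>. f \<in> borel_measurable borel \<and> (\<forall>x. f x \<ge> 0) \<and>
            \<nu> = density lborel (\<lambda>x. ennreal (f x)) \<and> \<alpha> > 0 \<and>
            f \<in> \<Theta>[at_top](\<lambda>x. exp (- (\<alpha> * sqrt x / ln x))) \<longrightarrow>
        \<not> hardy_condition \<nu> \<and>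
        (\<forall>c>0. (\<integral>\<^sup>+x\<in>{0..}. ennreal (exp (c * sqrt x) * f x) \<partial>lborel) = \<infinity>) \<and>
        moment_determinate \<nu>)"
proof -
  have sets: "sets \<nu> = sets borel" using assms(2) by (simp add: halfline_measure_def)
  have tail_iff: "hardy_condition \<nu> \<longleftrightarrow> (\<exists>c>0. tail \<nu> \<in> O[at_top](\<lambda>x. exp (- c * sqrt x)))"
  proof
    assume "hardy_condition \<nu>"
    thus "\<exists>c>0. tail \<nu> \<in> O[at_top](\<lambda>x. exp (- c * sqrt x))"
      unfolding hardy_condition_def using tail_bigo_of_hardy[OF assms(1) sets] by blast
  next
    assume "\<exists>c>0. tail \<nu> \<in> O[at_top](\<lambda>x. exp (- c * sqrt x))"
    then obtain c where c: "c > 0" "tail \<nu> \<in> O[at_top](\<lambda>x. exp (- c * sqrt x))" by blast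
    show "hardy_condition \<nu>"
      unfolding hardy_condition_def using hardy_of_tail_bigo[OF assms(1) sets c] c(1)
      by (intro exI[of _ "c / 2"]) auto
  qed
  have parabolic: "\<exists>c>0. \<exists>G. G = (\<lambda>x::real. c * exp (x / 2)) \<and>
           G \<in> asymptotically_parabolic_D \<and>
           tail \<nu> \<in> O[at_top](\<lambda>x. exp (- G (ln x))) \<and>
           strict_mono (deriv G) \<and>
           (\<exists>N\<ge>1. (\<forall>n\<ge>N. real n \<in> range (deriv G)) \<and>
                  (\<Sum>n. ennreal (exp (- (1/2) * inv (deriv G) (real (n + N))))) = \<infinity>)"
    if "hardy_condition \<nu>"
  proof -
    from that tail_iff obtain c where c: "c > 0" and O: "tail \<nu> \<in> O[at_top](\<lambda>x. exp (- c * sqrt x))" by blast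
    have "eventually (\<lambda>x. exp (- c * sqrt x) = exp (- (c * exp (ln x / 2)))) at_top"
      using eventually_gt_at_top[of 0]
    proof eventually_elim
      case (elim x)
      hence "exp (ln x / 2) = sqrt x" by (simp flip: ln_sqrt)
      thus ?case by simp
    qed
    from landau_o.big.cong[OF this] O
    have "tail \<nu> \<in> O[at_top](\<lambda>x. exp (- (c * exp (ln x / 2))))" by simp
    with c const_exp_half_asymptotically_parabolic_D[OF c] suminf_exp_half_inv_deriv_const_exp_half[OF c]
    show ?thesis by (intro exI[of _ c] conjI exI[of _ "\<lambda>x. c * exp (x / 2)"] exI[of _ "1::nat"] refl allI impI) auto
  qed
  have density: "\<not> hardy_condition \<nu> \<and>
        (\<forall>c>0. (\<integral>\<^sup>+x\<in>{0..}. ennreal (exp (c * sqrt x) * f x) \<partial>lborel) = \<infinity>) \<and>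
        moment_determinate \<nu>"
    if f: "f \<in> borel_measurable borel" "\<forall>x. f x \<ge> 0" "\<nu> = density lborel (\<lambda>x. ennreal (f x))"
      and \<alpha>: "\<alpha> > 0" and Theta: "f \<in> \<Theta>[at_top](\<lambda>x. exp (- (\<alpha> * sqrt x / ln x)))" for f \<alpha>
  proof (intro conjI)
    have O: "f \<in> O[at_top](\<lambda>x. exp (- (\<alpha> * sqrt x / ln x)))"
      and Om: "f \<in> \<Omega>[at_top](\<lambda>x. exp (- (\<alpha> * sqrt x / ln x)))"
      using Theta by (auto simp: bigtheta_def)
    note inf = density_not_exp_sqrt_integrable[OF f(1) f(2)[rule_format] _ Om]
    show "\<forall>c>0. (\<integral>\<^sup>+x\<in>{0..}. ennreal (exp (c * sqrt x) * f x) \<partial>lborel) = \<infinity>"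
      using inf by blast
    show "\<not> hardy_condition \<nu>"
    proof
      assume "hardy_condition \<nu>"
      then obtain c where c: "c > 0" "(\<integral>\<^sup>+x\<in>{0..}. ennreal (exp (c * sqrt x)) \<partial>\<nu>) < \<infinity>"
        unfolding hardy_condition_def by blast
      have "(\<integral>\<^sup>+x\<in>{0..}. ennreal (exp (c * sqrt x)) \<partial>\<nu>)
          = (\<integral>\<^sup>+x. ennreal (f x) * (ennreal (exp (c * sqrt x)) * indicator {0..} x) \<partial>lborel)"
        unfolding f(3) using f(1) by (intro nn_integral_density) auto
      also have "\<dots> = (\<integral>\<^sup>+x\<in>{0..}. ennreal (exp (c * sqrt x) * f x) \<partial>lborel)"
        using f(2) by (intro nn_integral_cong) (simp add: ennreal_mult' mult_ac)
      finally show False using c inf[OF c(1)] by simp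
    qed
    show "moment_determinate \<nu>"
      using density_log_exp_determinate[OF assms(1,2,4) f(1) _ f(3) \<alpha> O] f(2) by blast
  qed
  show ?thesis using tail_iff parabolic density by blast
qed

end
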